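(* $$\sum_{n\ge1}a_{n,3,00}x^n=\frac{x(1-3x+6x^2-5x^3+3x^4-x^5)}{(1-x)^6}.$$
   Context: For a finite integer sequence $(a_1,\dots,a_i)$, $\mathrm{asc}(a_1,\dots,a_i)=|\{j:1\le j<i,\ a_j<a_{j+1}\}|$. A $3$-ascent sequence of length $n\ge1$ is a sequence $(a_1,\dots,a_n)$ of nonnegative integers with $a_1=0$ and $a_i\le 3+\mathrm{asc}(a_1,\dots,a_{i-1})$ for all $2\le i\le n$. $a_{n,3,00}$ is the number of $3$-ascent sequences of length $n$ avoiding the pattern $00$, i.e. having all letters distinct. *)

theory Defs
  imports "HOL-Computational_Algebra.Formal_Power_Series"
begin

text \<open>
  Sequences are lists; the letter $a_{j+1}$ of the mathematical notation is \<open>a ! j\<close>.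
\<close>

definition asc :: "nat list \<Rightarrow> nat" where
  "asc a = card {j. Suc j < length a \<and> a ! j < a ! Suc j}"

definition ascent_seq :: "nat \<Rightarrow> nat list \<Rightarrow> bool" where
  "ascent_seq p a \<longleftrightarrow>
     a \<noteq> [] \<and> a ! 0 = 0 \<and> (\<forall>i. 1 \<le> i \<and> i < length a \<longrightarrow> a ! i \<le> p + asc (take i a))"

text \<open>
  An occurrence of the pattern \<open>q\<close> in \<open>a\<close> is a subsequence of \<open>a\<close>, at the positions
  \<open>f 0 < f 1 < \<dots>\<close>, that is order isomorphic to \<open>q\<close>. Comparing with \<open><\<close> for all pairs
  of positions in both orders also forces equal letters to correspond to equal letters.
\<close>

definition contains_pattern :: "nat list \<Rightarrow> nat list \<Rightarrow> bool" where
  "contains_pattern q a \<longleftrightarrow>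
     (\<exists>f. strict_mono_on {..<length q} f \<and> f ` {..<length q} \<subseteq> {..<length a} \<and>
          (\<forall>i<length q. \<forall>j<length q. a ! f i < a ! f j \<longleftrightarrow> q ! i < q ! j))"

abbreviation avoids_pattern :: "nat list \<Rightarrow> nat list \<Rightarrow> bool" where
  "avoids_pattern q a \<equiv> \<not> contains_pattern q a"

definition num_avoiding :: "nat \<Rightarrow> nat \<Rightarrow> nat list \<Rightarrow> nat" where
  "num_avoiding n p q = card {a. length a = n \<and> ascent_seq p a \<and> avoids_pattern q a}"

lemma avoids_00_iff_distinct: "avoids_pattern [0, 0] a \<longleftrightarrow> distinct a"
proof -
  have nth: "[0, 0::nat] ! i = 0" if "i < 2" for i
    using that by (cases i) auto
  have "contains_pattern [0, 0] a \<longleftrightarrow> (\<exists>i j. i < j \<and> j < length a \<and> a ! i = a ! j)"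
  proof
    assume "contains_pattern [0, 0] a"
    then obtain f where f: "strict_mono_on {..<length [0, 0::nat]} f"
        "f ` {..<length [0, 0::nat]} \<subseteq> {..<length a}"
        "\<forall>i<length [0, 0::nat]. \<forall>j<length [0, 0::nat].
           a ! f i < a ! f j \<longleftrightarrow> [0, 0::nat] ! i < [0, 0] ! j"
      unfolding contains_pattern_def by blast
    have le: "\<not> a ! f i < a ! f j" if "i < 2" "j < 2" for i j
      using f(3) nth[OF that(1)] nth[OF that(2)] that by simp
    have "f 0 < f 1" using f(1) by (auto simp: strict_mono_on_def)
    moreover have "f 1 < length a" using f(2) by auto
    moreover have "a ! f 0 = a ! f 1" using le[of 0 1] le[of 1 0] by simp
    ultimately show "\<exists>i j. i < j \<and> j < length a \<and> a ! i = a ! j" by blast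
  next
    assume "\<exists>i j. i < j \<and> j < length a \<and> a ! i = a ! j"
    then obtain i j where "i < j" "j < length a" "a ! i = a ! j" by blast
    then have "strict_mono_on {..<length [0, 0::nat]} (\<lambda>k. if k = 0 then i else j)"
      by (auto simp: strict_mono_on_def)
    moreover have "(\<lambda>k. if k = 0 then i else j) ` {..<length [0, 0::nat]} \<subseteq> {..<length a}"
      using \<open>i < j\<close> \<open>j < length a\<close> by auto
    moreover have "a ! (if k = 0 then i else j) < a ! (if l = 0 then i else j)
        \<longleftrightarrow> [0, 0::nat] ! k < [0, 0] ! l"
      if "k < length [0, 0::nat]" "l < length [0, 0::nat]" for k l
    proof -
      have "[0, 0::nat] ! k = 0" "[0, 0::nat] ! l = 0"
        using that nth by auto
      then show ?thesis
        using \<open>a ! i = a ! j\<close> by (simp only: if_distrib[of "(!) a"] if_cancel) simp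
    qed
    ultimately show "contains_pattern [0, 0] a"
      unfolding contains_pattern_def by blast
  qed
  also have "\<dots> \<longleftrightarrow> \<not> distinct a"
  proof
    assume "\<exists>i j. i < j \<and> j < length a \<and> a ! i = a ! j"
    then show "\<not> distinct a"
      by (auto simp: nth_eq_iff_index_eq)
  next
    assume "\<not> distinct a"
    then obtain i j where "i < length a" "j < length a" "i \<noteq> j" "a ! i = a ! j"
      by (auto simp: distinct_conv_nth)
    then show "\<exists>i j. i < j \<and> j < length a \<and> a ! i = a ! j"
      by (metis linorder_neqE_nat)
  qed
  finally show ?thesis by blast
qed

lemma asc_less: "a \<noteq> [] \<Longrightarrow> asc a < length a"
proof -
  assume "a \<noteq> []"
  have "asc a \<le> card {..<length a - 1}"
    unfolding asc_def by (rule card_mono) auto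
  then show ?thesis using \<open>a \<noteq> []\<close> by (cases a) auto
qed

lemma finite_ascent_seqs: "finite {a. length a = n \<and> ascent_seq p a}"
proof (rule finite_subset)
  show "{a. length a = n \<and> ascent_seq p a} \<subseteq> {a. set a \<subseteq> {..p + n} \<and> length a = n}"
  proof (clarsimp simp: in_set_conv_nth)
    fix a i assume a: "ascent_seq p a" "i < length a"
    show "a ! i \<le> p + length a"
    proof (cases "i = 0")
      case False
      then have "a ! i \<le> p + asc (take i a)" using a by (auto simp: ascent_seq_def)
      moreover have "asc (take i a) < length (take i a)"
        using False a by (intro asc_less) auto
      ultimately show ?thesis using a(2) by simp
    qed (use a in \<open>auto simp: ascent_seq_def\<close>)
  qed
  show "finite {a. set a \<subseteq> {..p + n} \<and> length a = n}"
    by (rule finite_lists_length_eq) simp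
qed

end

theory Submission
  imports Defs
begin

text \<open>
  Call a letter free after a prefix \<open>a\<close> if it may be appended to \<open>a\<close>: it is at most
  \<open>p + asc a\<close> and does not occur in \<open>a\<close>. Appending a free letter that creates an ascent consumes
  it but frees a new largest letter; appending one that creates a descent only consumes it. Hence
  the number of extensions of \<open>a\<close> depends only on the number \<open>k\<close> of free letters and the number
  \<open>j\<close> of those exceeding the last letter. For \<open>p = 3\<close> the start is \<open>k = j = 3\<close>, and the
  resulting triangular system for the generating functions has only the pole 1.
\<close>

section \<open>Free letters and the counting recursion\<close>

definition free :: "nat \<Rightarrow> nat list \<Rightarrow> nat set" where
  "free p a = {..p + asc a} - set a"

definition free_above :: "nat \<Rightarrow> nat list \<Rightarrow> nat set" where
  "free_above p a = {x \<in> free p a. last a < x}"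

definition extensions :: "nat \<Rightarrow> nat \<Rightarrow> nat list \<Rightarrow> nat list set" where
  "extensions p m a = {b. length b = m \<and> ascent_seq p (a @ b) \<and> distinct (a @ b)}"

text \<open>Here \<open>k\<close> counts the free letters and \<open>j\<close> those above the last
  letter. The first sum runs over ascents, the second over descents, with \<open>t\<close> or
  \<open>u\<close> free letters above the new last letter; \<open>t\<close> starts at 1 because an
  ascent always frees a larger letter.\<close>

primrec walks :: "nat \<Rightarrow> nat \<Rightarrow> nat \<Rightarrow> nat" where
  "walks 0 k j = 1"
| "walks (Suc m) k j = (\<Sum>t=1..j. walks m k t) + (\<Sum>u=j..<k. walks m (k - 1) u)"

lemma finite_free [simp]: "finite (free p a)" "finite (free_above p a)"
  by (auto simp: free_def free_above_def)

section \<open>Appending one letter\<close>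

lemma asc_snoc:
  assumes "a \<noteq> []"
  shows "asc (a @ [x]) = asc a + (if last a < x then 1 else 0)"
proof -
  let ?A = "{j. Suc j < length a \<and> a ! j < a ! Suc j}"
  \<comment> \<open>The only possible new ascent is at the junction, position
    \<open>length a - 1\<close>.\<close>
  have "{j. Suc j < length (a @ [x]) \<and> (a @ [x]) ! j < (a @ [x]) ! Suc j} =
      ?A \<union> (if last a < x then {length a - 1} else {})"
    (is "?B = ?C")
  proof (rule set_eqI)
    fix j
    show "j \<in> ?B \<longleftrightarrow> j \<in> ?C"
    proof (cases "Suc j = length a")
      case True
      then have "j = length a - 1" by simp
      moreover have "last a = a ! j" using assms calculation by (simp add: last_conv_nth)
      ultimately show ?thesis using True by (simp add: nth_append)
    next
      case False
      then have "j \<noteq> length a - 1" using assms by (cases a) auto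
      then show ?thesis using False by (auto simp: nth_append)
    qed
  qed
  moreover have "finite ?A" by (rule finite_subset[of _ "{..<length a}"]) auto
  moreover have "length a - 1 \<notin> ?A" by auto
  ultimately show ?thesis unfolding asc_def by simp
qed

lemma asc_mono_take: "asc (take i a) \<le> asc a"
  unfolding asc_def by (rule card_mono) (auto intro: finite_subset[of _ "{..<length a}"])

lemma ascent_seq_bound:
  assumes "ascent_seq p a"
  shows "set a \<subseteq> {..p + asc a}"
proof
  fix x assume "x \<in> set a"
  then obtain i where i: "i < length a" "x = a ! i" by (auto simp: in_set_conv_nth)
  show "x \<in> {..p + asc a}"
  proof (cases "i = 0")
    case False
    then have "x \<le> p + asc (take i a)" using assms i by (auto simp: ascent_seq_def)
    then show ?thesis using asc_mono_take[of i a] by simp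
  qed (use assms i in \<open>auto simp: ascent_seq_def\<close>)
qed

text \<open>The condition at position \<open>i\<close> sees only \<open>take i\<close>, so the
  earlier conditions are unaffected and one is added at position \<open>length a\<close>.\<close>

lemma ascent_seq_snoc:
  assumes "a \<noteq> []"
  shows "ascent_seq p (a @ [x]) \<longleftrightarrow> ascent_seq p a \<and> x \<le> p + asc a"
proof -
  have "(\<forall>i. 1 \<le> i \<and> i < length (a @ [x]) \<longrightarrow> (a @ [x]) ! i \<le> p + asc (take i (a @ [x]))) \<longleftrightarrow>
      (\<forall>i. 1 \<le> i \<and> i < length a \<longrightarrow> a ! i \<le> p + asc (take i a)) \<and> x \<le> p + asc a"
    (is "(\<forall>i. ?P i) \<longleftrightarrow> (\<forall>i. ?Q i) \<and> ?R")
  proof -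
    have "?P i \<longleftrightarrow> ?Q i \<and> (i = length a \<longrightarrow> ?R)" for i
      using assms by (cases "i = length a") (auto simp: nth_append Suc_le_eq)
    then show ?thesis by blast
  qed
  then show ?thesis
    using assms by (simp add: ascent_seq_def nth_append)
qed

section \<open>Extensions of a prefix\<close>

lemma finite_extensions: "finite (extensions p m a)"
proof (rule finite_subset)
  show "extensions p m a \<subseteq> (@) a -` {c. length c = length a + m \<and> ascent_seq p c}"
    by (auto simp: extensions_def)
  show "finite ((@) a -` {c. length c = length a + m \<and> ascent_seq p c})"
    by (intro finite_vimageI finite_ascent_seqs) (simp add: inj_def)
qed

lemma extensions_Suc:
  assumes "a \<noteq> []"
  shows "extensions p (Suc m) a = (\<Union>x\<in>free p a. (#) x ` extensions p m (a @ [x]))"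
proof (intro equalityI subsetI)
  fix b assume b: "b \<in> extensions p (Suc m) a"
  then obtain x c where bc: "b = x # c" by (cases b) (auto simp: extensions_def)
  have "\<forall>i. 1 \<le> i \<and> i < length (a @ b) \<longrightarrow> (a @ b) ! i \<le> p + asc (take i (a @ b))"
    using b by (auto simp: extensions_def ascent_seq_def)
  \<comment> \<open>At this index \<open>take\<close> returns exactly \<open>a\<close>, and the
    letter is \<open>x\<close>.\<close>
  from this[rule_format, of "length a"] have "x \<le> p + asc a"
    using assms bc by (cases a) auto
  then show "b \<in> (\<Union>x\<in>free p a. (#) x ` extensions p m (a @ [x]))"
    using b bc by (auto simp: extensions_def free_def)
qed (auto simp: extensions_def)

lemma card_extensions_Suc:
  assumes "a \<noteq> []"
  shows "card (extensions p (Suc m) a) = (\<Sum>x\<in>free p a. card (extensions p m (a @ [x])))"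
  unfolding extensions_Suc[OF assms]
  by (subst card_UN_disjoint) (auto simp: finite_extensions card_image)

text \<open>Counting the larger elements ranks \<open>A\<close> bijectively onto
  \<open>{..<card A}\<close>. In the induction a new minimum gets rank \<open>card A\<close> and
  changes no other rank.\<close>

lemma sum_card_greater:
  fixes A :: "'a::linorder set" and f :: "nat \<Rightarrow> 'b::comm_monoid_add"
  assumes "finite A"
  shows "(\<Sum>x\<in>A. f (card {y\<in>A. x < y})) = sum f {..<card A}"
  using assms
proof (induction A rule: finite_linorder_min_induct)
  case (insert b A)
  then have "b \<notin> A" by auto
  have "{y \<in> insert b A. b < y} = A" using insert by auto
  moreover have "{y \<in> insert b A. x < y} = {y \<in> A. x < y}" if "x \<in> A" for x
    using insert that by force
  ultimately show ?case
    using insert \<open>b \<notin> A\<close> by (simp add: add.commute)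
qed simp

section \<open>Evolution of the free letters and the count of extensions\<close>

lemma free_snoc:
  assumes "ascent_seq p a" "x \<in> free p a"
  shows "free p (a @ [x]) =
    (if last a < x then insert (Suc (p + asc a)) (free p a - {x}) else free p a - {x})"
proof -
  have "a \<noteq> []" using assms by (simp add: ascent_seq_def)
  then show ?thesis
    using ascent_seq_bound[OF assms(1)] assms(2)
    by (auto simp: free_def asc_snoc le_Suc_eq)
qed

lemma card_free_snoc:
  assumes "ascent_seq p a" "x \<in> free p a"
  shows "card (free p (a @ [x])) = (if last a < x then card (free p a) else card (free p a) - 1)"
proof -
  \<comment> \<open>Positivity lets the loss of \<open>x\<close> and the gain of a new letter cancel
    under truncated subtraction.\<close>
  have "Suc (p + asc a) \<notin> free p a" "card (free p a) > 0"
    using assms(2) by (auto simp: free_def card_gt_0_iff)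
  then show ?thesis
    using assms by (simp add: free_snoc)
qed

text \<open>After an ascent, the free letters above \<open>x\<close> survive and the new largest one
  joins them. After a descent, all letters previously above the last one still count, joined by the
  free letters between \<open>x\<close> and \<open>last a\<close>.\<close>

lemma card_free_above_snoc:
  assumes "ascent_seq p a" "x \<in> free p a"
  shows "card (free_above p (a @ [x])) =
    (if last a < x then Suc (card {y \<in> free_above p a. x < y})
     else card (free_above p a) + card {y \<in> free p a - free_above p a. x < y})"
proof (cases "last a < x")
  case True
  have "free_above p (a @ [x]) = insert (Suc (p + asc a)) {y \<in> free_above p a. x < y}"
    using True assms by (auto simp: free_above_def free_snoc) (auto simp: free_def)
  moreover have "Suc (p + asc a) \<notin> free_above p a"
    by (simp add: free_above_def free_def)
  ultimately show ?thesis using True by simp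
next
  case False
  have "free_above p (a @ [x]) = free_above p a \<union> {y \<in> free p a - free_above p a. x < y}"
    using False assms by (auto simp: free_above_def free_snoc)
  then show ?thesis
    using False by (simp add: card_Un_disjoint disjoint_iff)
qed

text \<open>The next letter lies in \<open>A\<close> (ascent) or \<open>B\<close> (descent). In
  either case the new parameters depend only on its rank within that set, so
  \<open>sum_card_greater\<close> turns the sums over letters into those of
  \<open>walks\<close>.\<close>

theorem card_extensions:
  assumes "ascent_seq p a" "distinct a"
  shows "card (extensions p m a) = walks m (card (free p a)) (card (free_above p a))"
  using assms
proof (induction m arbitrary: a)
  case 0
  then have "extensions p 0 a = {[]}" by (auto simp: extensions_def)
  then show ?case by simp
next
  case (Suc m)
  define A where "A = free_above p a"
  define B where "B = free p a - A"
  define k where "k = card (free p a)"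
  define j where "j = card A"
  have ne: "a \<noteq> []" using Suc.prems by (simp add: ascent_seq_def)
  have fin: "finite A" "finite B" and AB: "free p a = A \<union> B" "A \<inter> B = {}"
    by (auto simp: A_def B_def free_above_def)
  have k: "k = j + card B" unfolding k_def j_def AB(1) using fin AB(2) by (rule card_Un_disjoint)
  have step: "card (extensions p m (a @ [x])) =
      walks m (card (free p (a @ [x]))) (card (free_above p (a @ [x])))" if "x \<in> free p a" for x
    using that Suc.prems ne by (intro Suc.IH) (auto simp: ascent_seq_snoc free_def)
  have "card (extensions p (Suc m) a) =
      (\<Sum>x\<in>A. card (extensions p m (a @ [x]))) + (\<Sum>x\<in>B. card (extensions p m (a @ [x])))"
    unfolding card_extensions_Suc[OF ne] AB(1) using fin AB(2) by (rule sum.union_disjoint)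
  also have "(\<Sum>x\<in>A. card (extensions p m (a @ [x]))) =
      (\<Sum>x\<in>A. walks m k (Suc (card {y\<in>A. x < y})))"
  proof (rule sum.cong)
    fix x assume "x \<in> A"
    then have "x \<in> free p a" "last a < x" by (auto simp: A_def free_above_def)
    then show "card (extensions p m (a @ [x])) = walks m k (Suc (card {y\<in>A. x < y}))"
      using Suc.prems by (simp add: step card_free_snoc card_free_above_snoc k_def A_def)
  qed simp
  also have "\<dots> = (\<Sum>t<j. walks m k (Suc t))"
    unfolding j_def using fin(1) by (rule sum_card_greater[where f = "\<lambda>t. walks m k (Suc t)"])
  also have "\<dots> = (\<Sum>t=1..j. walks m k t)"
    by (rule sum.reindex_bij_witness[of _ "\<lambda>t. t - 1" Suc]) auto
  also have "(\<Sum>x\<in>B. card (extensions p m (a @ [x]))) =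
      (\<Sum>x\<in>B. walks m (k - 1) (j + card {y\<in>B. x < y}))"
  proof (rule sum.cong)
    fix x assume "x \<in> B"
    then have "x \<in> free p a" "\<not> last a < x" by (auto simp: A_def B_def free_above_def)
    then show "card (extensions p m (a @ [x])) = walks m (k - 1) (j + card {y\<in>B. x < y})"
      using Suc.prems by (simp add: step card_free_snoc card_free_above_snoc k_def j_def B_def A_def)
  qed simp
  also have "\<dots> = (\<Sum>u<card B. walks m (k - 1) (j + u))"
    using fin(2) by (rule sum_card_greater[where f = "\<lambda>u. walks m (k - 1) (j + u)"])
  also have "\<dots> = (\<Sum>u=j..<k. walks m (k - 1) u)"
    by (rule sum.reindex_bij_witness[of _ "\<lambda>u. u - j" "\<lambda>u. j + u"]) (auto simp: k)
  finally show ?case by (simp add: k_def j_def A_def)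
qed

text \<open>Every sequence counted extends \<open>[0]\<close>, after which the free letters are
  \<open>{1..p}\<close>, all above 0.\<close>

lemma num_avoiding_00: "num_avoiding (Suc m) p [0, 0] = walks m p p"
proof -
  have asc0: "asc [0] = 0" by (simp add: asc_def)
  have "{a. length a = Suc m \<and> ascent_seq p a \<and> avoids_pattern [0, 0] a} =
      (#) 0 ` extensions p m [0]"
    unfolding avoids_00_iff_distinct
  proof (intro equalityI subsetI)
    fix a assume a: "a \<in> {a. length a = Suc m \<and> ascent_seq p a \<and> distinct a}"
    then obtain b where "a = 0 # b" by (cases a) (auto simp: ascent_seq_def)
    then show "a \<in> (#) 0 ` extensions p m [0]" using a by (auto simp: extensions_def)
  qed (auto simp: extensions_def)
  then have "num_avoiding (Suc m) p [0, 0] = card (extensions p m [0])"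
    by (simp add: num_avoiding_def card_image)
  also have "\<dots> = walks m (card (free p [0])) (card (free_above p [0]))"
    by (rule card_extensions) (auto simp: ascent_seq_def)
  also have "free p [0] = {1..p}" by (auto simp: free_def asc0)
  also have "free_above p [0] = {1..p}" by (auto simp: free_above_def free_def asc0)
  finally show ?thesis by simp
qed

section \<open>Generating functions\<close>

definition walks_fps :: "nat \<Rightarrow> nat \<Rightarrow> rat fps" where
  "walks_fps k j = Abs_fps (\<lambda>m. of_nat (walks m k j))"

lemma walks_fps_eq:
  "walks_fps k j = 1 + fps_X * ((\<Sum>t=1..j. walks_fps k t) + (\<Sum>u=j..<k. walks_fps (k - 1) u))"
proof (rule fps_ext)
  fix n
  show "fps_nth (walks_fps k j) n = fps_nth (1 + fps_X *
      ((\<Sum>t=1..j. walks_fps k t) + (\<Sum>u=j..<k. walks_fps (k - 1) u))) n"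
    by (cases n) (simp_all add: walks_fps_def fps_sum_nth)
qed

text \<open>In the order 11, 21, 22, 31, 32, 33 each equation involves only earlier unknowns and its
  own, the latter with coefficient \<open>1 - X\<close> after rearranging. Each solution thus adds
  one factor \<open>1 - X\<close>, whence the exponent 6.\<close>

lemma walks_fps_3_3:
  "walks_fps 3 3 * (1 - fps_X) ^ 6 =
    1 - 3 * fps_X + 6 * fps_X ^ 2 - 5 * fps_X ^ 3 + 3 * fps_X ^ 4 - fps_X ^ 5"
proof -
  define X :: "rat fps" where "X = fps_X"
  define F where "F = walks_fps"
  have rec: "F k j = 1 + X * ((\<Sum>t=1..j. F k t) + (\<Sum>u=j..<k. F (k - 1) u))" for k j
    unfolding F_def X_def by (rule walks_fps_eq)
  have F11: "F 1 1 = 1 + X * F 1 1"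
    using rec[of 1 1] by simp
  have F21: "F 2 1 = 1 + X * (F 2 1 + F 1 1)"
    using rec[of 2 1] by (simp add: eval_nat_numeral)
  have F22: "F 2 2 = 1 + X * (F 2 1 + F 2 2)"
    using rec[of 2 2] by (simp add: eval_nat_numeral)
  have F31: "F 3 1 = 1 + X * (F 3 1 + F 2 1 + F 2 2)"
    using rec[of 3 1] by (simp add: eval_nat_numeral add.assoc)
  have F32: "F 3 2 = 1 + X * (F 3 1 + F 3 2 + F 2 2)"
    using rec[of 3 2] by (simp add: eval_nat_numeral)
  have F33: "F 3 3 = 1 + X * (F 3 1 + F 3 2 + F 3 3)"
    using rec[of 3 3] by (simp add: eval_nat_numeral)
  have 11: "F 1 1 * (1 - X) = 1"
    using F11 by algebra
  have 21: "F 2 1 * (1 - X) ^ 2 = 1"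
    using F21 11 by algebra
  have 22: "F 2 2 * (1 - X) ^ 3 = (1 - X) ^ 2 + X"
    using F22 21 by algebra
  have 31: "F 3 1 * (1 - X) ^ 4 = (1 - X) ^ 3 + X * (1 - X) + X * ((1 - X) ^ 2 + X)"
    using F31 21 22 by algebra
  \<comment> \<open>The products with powers of \<open>1 - X\<close> stay intact so that
    \<open>31\<close> and \<open>22\<close> can be substituted literally below.\<close>
  have 32: "F 3 2 * (1 - X) ^ 5 = (1 - X) ^ 4 + X * (F 3 1 * (1 - X) ^ 4)
      + X * (1 - X) * (F 2 2 * (1 - X) ^ 3)"
    using F32 by algebra
  have "F 3 3 * (1 - X) ^ 6 = (1 - X) ^ 5 + X * (1 - X) * (F 3 1 * (1 - X) ^ 4)
      + X * (F 3 2 * (1 - X) ^ 5)"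
    using F33 by algebra
  also have "\<dots> = 1 - 3 * X + 6 * X ^ 2 - 5 * X ^ 3 + 3 * X ^ 4 - X ^ 5"
    unfolding 32 31 22 by algebra
  finally have "F 3 3 * (1 - X) ^ 6 = 1 - 3 * X + 6 * X ^ 2 - 5 * X ^ 3 + 3 * X ^ 4 - X ^ 5" .
  then show ?thesis by (simp only: F_def X_def)
qed

theorem theorem4p3:
  shows "Abs_fps (\<lambda>n. if n \<ge> 1 then of_nat (num_avoiding n 3 [0, 0]) else 0) =
    (fps_X * (1 - 3 * fps_X + 6 * fps_X ^ 2 - 5 * fps_X ^ 3 + 3 * fps_X ^ 4 - fps_X ^ 5)
      / (1 - fps_X) ^ 6 :: rat fps)"
proof -
  \<comment> \<open>Length \<open>Suc m\<close> corresponds to \<open>m\<close> appended letters;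
    the factor \<open>fps_X\<close> makes this shift and gives the coefficient 0 at
    \<open>n = 0\<close>.\<close>
  have "Abs_fps (\<lambda>n. if n \<ge> 1 then of_nat (num_avoiding n 3 [0, 0]) else 0) =
      fps_X * walks_fps 3 3" (is "?L = _")
  proof (rule fps_ext)
    fix n
    show "fps_nth ?L n = fps_nth (fps_X * walks_fps 3 3) n"
      by (cases n) (simp_all add: walks_fps_def num_avoiding_00)
  qed
  also have "\<dots> = fps_X * (walks_fps 3 3 * (1 - fps_X) ^ 6) / (1 - fps_X) ^ 6"
  proof -
    \<comment> \<open>The nonzero constant term shows that \<open>1 - fps_X\<close> is nonzero, so
      its sixth power cancels.\<close>
    have "fps_nth (1 - fps_X :: rat fps) 0 \<noteq> 0" by simp
    then have "(1 - fps_X :: rat fps) \<noteq> 0" by (metis fps_zero_nth)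
    then show ?thesis by (simp flip: mult.assoc)
  qed
  finally show ?thesis by (simp only: walks_fps_3_3)
qed

end
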